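(* Let $X_1,\ldots,X_n$ be i.i.d. observations with density $f$ with respect to $\mu$. Assume that the functions $f_1,\ldots,f_M\in L^2(\mu)$ satisfy $\|f_j\|_\infty\le L_0$ for all $j=1,\ldots,M$. Define $$\hat J\in\operatorname*{argmin}_{j=1,\ldots,M}\left(\|f_j\|^2-\frac2n\sum_{i=1}^n f_j(X_i)\right).$$ Then for any $x>0$, with probability greater than $1-\exp(-x)$, $$R(f_{\hat J})\le \min_{j=1,\ldots,M}R(f_j)+L_0\left(4\sqrt2\,\sqrt{\frac{x+\log M}{n}}+\frac{8(x+\log M)}{3n}\right).$$
   Context: $(\mathcal{X},\mu)$ is a measure space, $f$ is an unknown probability density with respect to $\mu$, and $f_1,\ldots,f_M$ are deterministic functions. $\|\cdot\|$ denotes the $L^2(\mu)$ norm. The risk of $g\in L^2(\mu)$ is $R(g)=\|g\|^2-2\int g f\,d\mu$; for a random (data-dependent) function such as $f_{\hat J}$, $R(f_{\hat J})$ is the value of $R$ at the realized function. *)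

theory Defs
  imports "HOL-Probability.Probability" "HOL-Probability.Essential_Supremum"
begin

text \<open>Real-valued (representatives of) elements of \<open>L\<^sup>2(\<mu>)\<close>, and the norm of that space.\<close>

definition L2_space :: "'a measure \<Rightarrow> ('a \<Rightarrow> real) set" where
  "L2_space \<mu> = {g \<in> borel_measurable \<mu>. integrable \<mu> (\<lambda>x. (g x)\<^sup>2)}"

definition L2_norm :: "'a measure \<Rightarrow> ('a \<Rightarrow> real) \<Rightarrow> real" where
  "L2_norm \<mu> g = sqrt (\<integral>x. (g x)\<^sup>2 \<partial>\<mu>)"

text \<open>The sup norm is the \<open>L\<^sup>\<infinity>(\<mu>)\<close> norm, i.e. an essential supremum; it may be infinite.\<close>

definition Linf_norm :: "'a measure \<Rightarrow> ('a \<Rightarrow> real) \<Rightarrow> ereal" where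
  "Linf_norm \<mu> g = esssup \<mu> (\<lambda>x. ereal \<bar>g x\<bar>)"

text \<open>Measurability and integrability of \<open>f\<close> are part of \<open>has_bochner_integral\<close>.\<close>

definition prob_density :: "'a measure \<Rightarrow> ('a \<Rightarrow> real) \<Rightarrow> bool" where
  "prob_density \<mu> f \<longleftrightarrow> (AE x in \<mu>. 0 \<le> f x) \<and> has_bochner_integral \<mu> f 1"

definition risk :: "'a measure \<Rightarrow> ('a \<Rightarrow> real) \<Rightarrow> ('a \<Rightarrow> real) \<Rightarrow> real" where
  "risk \<mu> f g = (L2_norm \<mu> g)\<^sup>2 - 2 * (\<integral>x. g x * f x \<partial>\<mu>)"

end

theory Submission imports Defs "HOL-Probability.Hoeffding" begin

text \<open>
  Let \<open>k\<close> minimise the risk. Minimality of \<open>J\<close> for the empirical risk bounds the excess risk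
  \<open>R(f\<^sub>J) - R(f\<^sub>k)\<close> by twice the deviation of the empirical mean of \<open>f\<^sub>J - f\<^sub>k\<close> from its expectation.
  Since \<open>\<bar>f\<^sub>j - f\<^sub>k\<bar> \<le> 2L\<^sub>0\<close>, Hoeffding's inequality controls this deviation for each fixed \<open>j\<close> and
  already yields the square-root term with the constant \<open>4\<surd>2\<close>; the Bernstein-type linear term is
  pure slack. The union bound runs only over the \<open>M - 1\<close> indices \<open>j \<noteq> k\<close>, which makes the
  probability bound strict.
\<close>

text \<open>The intervals have length \<open>2 * c\<close>, so at deviation
  \<open>c * sqrt (2 * t * card I)\<close> the Hoeffding exponent is exactly \<open>- t\<close>. The
  event uses a strict inequality so that the bound survives \<open>c = 0\<close>, where the
  non-strict event has probability 1.\<close>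

lemma (in prob_space) Hoeffding_symmetric_interval:
  fixes Y :: "'b \<Rightarrow> 'a \<Rightarrow> real" and c t :: real
  assumes fin: "finite I" and ne: "I \<noteq> {}"
    and indep: "indep_vars (\<lambda>_. borel) Y I"
    and bd: "\<And>i. i \<in> I \<Longrightarrow> AE \<omega> in M. \<bar>Y i \<omega>\<bar> \<le> c"
    and t: "t \<ge> 0"
  shows "prob {\<omega> \<in> space M.
           (\<Sum>i\<in>I. Y i \<omega>) > (\<Sum>i\<in>I. expectation (Y i)) + c * sqrt (2 * t * card I)} \<le> exp (- t)"
proof -
  interpret Hoeffding_ineq M I Y "\<lambda>_. - c" "\<lambda>_. c" "\<Sum>i\<in>I. expectation (Y i)"
  proof unfold_locales
    fix i assume "i \<in> I"
    show "AE \<omega> in M. Y i \<omega> \<in> {- c..c}"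
      by (rule eventually_mono[OF bd[OF \<open>i \<in> I\<close>]]) auto
  qed (use fin indep in auto)
  obtain i where i: "i \<in> I"
    using ne by auto
  have "AE \<omega> in M. 0 \<le> c"
    by (rule eventually_mono[OF bd[OF i]]) auto
  then have "c \<ge> 0"
    by simp
  \<comment> \<open>For \<open>c = 0\<close> the denominator of the Hoeffding exponent vanishes;
    there the sum is almost surely 0 and the event is null.\<close>
  then consider "c = 0" | "c > 0"
    by linarith
  then show ?thesis
  proof cases
    case 1
    have "AE \<omega> in M. \<forall>i\<in>I. Y i \<omega> = 0"
      using bd fin 1 by (auto simp: AE_ball_countable countable_finite)
    then have "AE \<omega> in M. \<not> (\<Sum>i\<in>I. Y i \<omega>) > 0"
      by eventually_elim simp
    moreover have "expectation (Y i) = 0" if "i \<in> I" for i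
      using bd[OF that] 1 by (intro integral_eq_zero_AE) auto
    ultimately have "prob {\<omega> \<in> space M.
        (\<Sum>i\<in>I. Y i \<omega>) > (\<Sum>i\<in>I. expectation (Y i)) + c * sqrt (2 * t * card I)} = 0"
      using 1 by (subst prob_eq_0) auto
    then show ?thesis
      by simp
  next
    case 2
    let ?e = "c * sqrt (2 * t * card I)"
    have card: "card I > 0"
      using fin ne by (simp add: card_gt_0_iff)
    have "prob {\<omega> \<in> space M. (\<Sum>i\<in>I. Y i \<omega>) > (\<Sum>i\<in>I. expectation (Y i)) + ?e}
      \<le> prob {\<omega> \<in> space M. (\<Sum>i\<in>I. Y i \<omega>) \<ge> (\<Sum>i\<in>I. expectation (Y i)) + ?e}"
      by (intro finite_measure_mono) auto
    also have "\<dots> \<le> exp (- 2 * ?e\<^sup>2 / (\<Sum>i\<in>I. (c - - c)\<^sup>2))"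
      using 2 t card by (intro Hoeffding_ineq_ge) auto
    also have "- 2 * ?e\<^sup>2 / (\<Sum>i\<in>I. (c - - c)\<^sup>2) = - t"
      using 2 t card by (simp add: power_mult_distrib field_simps power2_eq_square)
    finally show ?thesis .
  qed
qed

lemma AE_abs_le_if_Linf_norm_le:
  assumes "Linf_norm \<mu> g \<le> ereal c"
  shows "AE x in \<mu>. \<bar>g x\<bar> \<le> c"
  using esssup_AE[of "\<lambda>x. ereal \<bar>g x\<bar>" \<mu>]
proof eventually_elim
  case (elim x)
  then have "ereal \<bar>g x\<bar> \<le> ereal c"
    using assms unfolding Linf_norm_def by (rule order_trans)
  then show ?case
    by simp
qed

theorem theorem2p2:
  fixes \<mu> :: "'a measure" and \<Omega> :: "'w measure"
    and f :: "'a \<Rightarrow> real" and F :: "nat \<Rightarrow> 'a \<Rightarrow> real"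
    and X :: "nat \<Rightarrow> 'w \<Rightarrow> 'a" and J :: "'w \<Rightarrow> nat"
    and n M :: nat and L0 x :: real
  assumes "prob_space \<Omega>"
    and "n \<ge> 1" and "M \<ge> 1"
    and "prob_density \<mu> f"
    and "prob_space.indep_vars \<Omega> (\<lambda>_. \<mu>) X {1..n}"
    and "\<And>i. i \<in> {1..n} \<Longrightarrow> distributed \<Omega> \<mu> (X i) (\<lambda>y. ennreal (f y))"
    and "\<And>j. j \<in> {1..M} \<Longrightarrow> F j \<in> L2_space \<mu>"
    and "\<And>j. j \<in> {1..M} \<Longrightarrow> Linf_norm \<mu> (F j) \<le> ereal L0"
    and "J \<in> measurable \<Omega> (count_space {1..M})"
    and "\<And>\<omega>. \<omega> \<in> space \<Omega> \<Longrightarrow>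
           is_arg_min (\<lambda>j. (L2_norm \<mu> (F j))\<^sup>2 - 2 / real n * (\<Sum>i=1..n. F j (X i \<omega>)))
             (\<lambda>j. j \<in> {1..M}) (J \<omega>)"
    and "x > 0"
  shows "measure \<Omega> {\<omega> \<in> space \<Omega>.
           risk \<mu> f (F (J \<omega>)) \<le> (MIN j\<in>{1..M}. risk \<mu> f (F j))
             + L0 * (4 * sqrt 2 * sqrt ((x + ln (real M)) / real n)
                     + 8 * (x + ln (real M)) / (3 * real n))}
         > 1 - exp (- x)"
proof -
  interpret prob_space \<Omega> by fact
  note indep = assms(5) and dist = assms(6)
  have n: "n > 0" and M: "M > 0"
    using assms(2,3) by auto
  have f_meas [measurable]: "f \<in> borel_measurable \<mu>" and f_int: "integrable \<mu> f"
    and f_nonneg: "AE y in \<mu>. 0 \<le> f y"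
    using assms(4) by (auto simp: prob_density_def has_bochner_integral_iff)
  have F_meas [measurable]: "F j \<in> borel_measurable \<mu>" if "j \<in> {1..M}" for j
    using assms(7)[OF that] by (auto simp: L2_space_def)
  have F_bd: "AE y in \<mu>. \<bar>F j y\<bar> \<le> L0" if "j \<in> {1..M}" for j
    using assms(8)[OF that] by (rule AE_abs_le_if_Linf_norm_le)
  have X_meas [measurable]: "X i \<in> measurable \<Omega> \<mu>" if "i \<in> {1..n}" for i
    using dist[OF that] by (rule distributed_measurable)
  have X_distr: "distr \<Omega> \<mu> (X i) = density \<mu> (\<lambda>y. ennreal (f y))" if "i \<in> {1..n}" for i
    using dist[OF that] by (rule distributed_distr_eq_density)
  \<comment> \<open>The law of \<open>X i\<close> has a density with respect to
    \<open>\<mu>\<close>, so \<open>\<mu>\<close>-null sets are null for it. This carries the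
    essential bounds over to the sample.\<close>
  have AE_X: "AE \<omega> in \<Omega>. P (X i \<omega>)" if "i \<in> {1..n}" "AE y in \<mu>. P y" for i P
  proof (rule AE_distrD[OF X_meas[OF that(1)]])
    show "AE y in distr \<Omega> \<mu> (X i). P y"
      unfolding X_distr[OF that(1)] using that(2) by (subst AE_density) auto
  qed
  have E_X: "expectation (\<lambda>\<omega>. g (X i \<omega>)) = (\<integral>y. g y * f y \<partial>\<mu>)"
    if "i \<in> {1..n}" and [measurable]: "g \<in> borel_measurable \<mu>" for i and g :: "'a \<Rightarrow> real"
  proof -
    have "expectation (\<lambda>\<omega>. g (X i \<omega>)) = (\<integral>y. g y \<partial>distr \<Omega> \<mu> (X i))"
      using that by (subst integral_distr) auto
    also have "\<dots> = (\<integral>y. g y * f y \<partial>\<mu>)"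
      unfolding X_distr[OF that(1)] using f_nonneg
      by (subst integral_density) (auto simp: mult.commute)
    finally show ?thesis .
  qed
  have Ff_int: "integrable \<mu> (\<lambda>y. F j y * f y)" if j: "j \<in> {1..M}" for j
  proof (rule Bochner_Integration.integrable_bound)
    show "integrable \<mu> (\<lambda>y. L0 * f y)"
      using f_int by simp
    show "AE y in \<mu>. norm (F j y * f y) \<le> norm (L0 * f y)"
      using F_bd[OF j] by eventually_elim (auto simp: abs_mult intro!: mult_right_mono)
  qed (use j in measurable)

  \<comment> \<open>Chosen so that each index receives a share \<open>exp (- x) / real M\<close> in
    the union bound.\<close>
  define t where "t = x + ln (real M)"
  have t: "t \<ge> 0"
    using assms(11) M by (simp add: t_def)
  have exp_t: "exp (- t) = exp (- x) / real M"
    using M by (simp add: t_def exp_diff exp_minus exp_add field_simps)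
  \<comment> \<open>The sign of \<open>L0\<close> is read off from the bound at a single
    observation: on a probability space a constant statement that holds almost everywhere is
    true.\<close>
  have L0: "L0 \<ge> 0"
  proof -
    have "AE \<omega> in \<Omega>. \<bar>F 1 (X 1 \<omega>)\<bar> \<le> L0"
      using n M F_bd[of 1] by (intro AE_X) auto
    then have "AE \<omega> in \<Omega>. 0 \<le> L0"
      by eventually_elim auto
    then show ?thesis
      by simp
  qed

  let ?m = "MIN j\<in>{1..M}. risk \<mu> f (F j)"
  have "?m \<in> (\<lambda>j. risk \<mu> f (F j)) ` {1..M}"
    using M by (intro Min_in) auto
  then obtain k where k: "k \<in> {1..M}" and k_min: "?m = risk \<mu> f (F k)"
    by blast

  \<comment> \<open>Comparing with the deterministic index \<open>k\<close> keeps the summands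
    independent for each fixed \<open>j\<close>; the randomness of \<open>J\<close> is left to the
    union bound. The threshold is that of Hoeffding with \<open>c = 2 * L0\<close>.\<close>
  define B where "B j = {\<omega> \<in> space \<Omega>. (\<Sum>i=1..n. F j (X i \<omega>) - F k (X i \<omega>))
      > real n * (\<integral>y. (F j y - F k y) * f y \<partial>\<mu>) + 2 * L0 * sqrt (2 * t * real n)}" for j
  have B_meas [measurable]: "B j \<in> sets \<Omega>" if [measurable]: "j \<in> {1..M}" for j
    unfolding B_def using k by measurable
  have B_prob: "prob (B j) \<le> exp (- t)" if j: "j \<in> {1..M}" for j
  proof -
    have bd: "AE \<omega> in \<Omega>. \<bar>F j (X i \<omega>) - F k (X i \<omega>)\<bar> \<le> 2 * L0" if i: "i \<in> {1..n}" for i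
      using AE_X[OF i F_bd[OF j]] AE_X[OF i F_bd[OF k]] by eventually_elim linarith
    have "indep_vars (\<lambda>_. borel) (\<lambda>i \<omega>. F j (X i \<omega>) - F k (X i \<omega>)) {1..n}"
      using j k by (intro indep_vars_compose2[OF indep, where Y = "\<lambda>_ y. F j y - F k y"]) auto
    from Hoeffding_symmetric_interval[OF _ _ this bd t] n
    have "prob {\<omega> \<in> space \<Omega>. (\<Sum>i=1..n. F j (X i \<omega>) - F k (X i \<omega>))
      > (\<Sum>i=1..n. expectation (\<lambda>\<omega>. F j (X i \<omega>) - F k (X i \<omega>))) + 2 * L0 * sqrt (2 * t * real n)}
      \<le> exp (- t)"
      by simp
    also have "(\<Sum>i=1..n. expectation (\<lambda>\<omega>. F j (X i \<omega>) - F k (X i \<omega>)))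
      = (\<Sum>i=1..n. \<integral>y. (F j y - F k y) * f y \<partial>\<mu>)"
      using j k by (intro sum.cong refl E_X[of _ "\<lambda>y. F j y - F k y"]) auto
    finally show ?thesis
      by (simp add: B_def)
  qed

  let ?c = "?m + L0 * (4 * sqrt 2 * sqrt ((x + ln (real M)) / real n)
    + 8 * (x + ln (real M)) / (3 * real n))"
  define G where "G = {\<omega> \<in> space \<Omega>. risk \<mu> f (F (J \<omega>)) \<le> ?c}"
  have G_meas: "G \<in> sets \<Omega>"
  proof -
    \<comment> \<open>The risk depends on \<open>\<omega>\<close> only through \<open>J\<close>, so
      \<open>G\<close> is the preimage of a set of indices.\<close>
    have "G = J -` {j \<in> {1..M}. risk \<mu> f (F j) \<le> ?c} \<inter> space \<Omega>"
      using measurable_space[OF assms(9)] by (auto simp: G_def)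
    also have "\<dots> \<in> sets \<Omega>"
      by (intro measurable_sets[OF assms(9)]) auto
    finally show ?thesis .
  qed

  have "space \<Omega> - G \<subseteq> (\<Union>j\<in>{1..M} - {k}. B j)"
  proof
    fix \<omega> assume "\<omega> \<in> space \<Omega> - G"
    then have \<omega>: "\<omega> \<in> space \<Omega>" and bad: "risk \<mu> f (F (J \<omega>)) > ?c"
      by (auto simp: G_def)
    define j where "j = J \<omega>"
    define N where "N i = (L2_norm \<mu> (F i))\<^sup>2" for i
    define S where "S i = (\<Sum>l=1..n. F i (X l \<omega>))" for i
    define A where "A i = (\<integral>y. F i y * f y \<partial>\<mu>)" for i
    have j: "j \<in> {1..M}"
      using measurable_space[OF assms(9) \<omega>] by (simp add: j_def)
    have "N j - 2 / real n * S j \<le> N k - 2 / real n * S k"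
      using assms(10)[OF \<omega>] k unfolding is_arg_min_def N_def S_def j_def by (meson not_le)
    then have "real n * (N j - 2 / real n * S j) \<le> real n * (N k - 2 / real n * S k)"
      by (rule mult_left_mono) simp
    then have emp: "real n * N j - 2 * S j \<le> real n * N k - 2 * S k"
      using n by (simp add: right_diff_distrib)
    define s where "s = sqrt (2 * t * real n)"
    \<comment> \<open>The square-root term is twice the Hoeffding threshold
      \<open>2 * L0 * s\<close>, divided by \<open>n\<close>.\<close>
    have main_term: "L0 * (4 * sqrt 2 * sqrt (t / real n)) = 4 * L0 * s / real n"
      using n by (simp add: s_def real_sqrt_mult real_sqrt_divide field_simps)
    have nonneg: "L0 * (8 * t / (3 * real n)) \<ge> 0" "4 * L0 * s / real n \<ge> 0"
      using L0 t by (simp_all add: s_def)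
    have "risk \<mu> f (F j) > risk \<mu> f (F k)
        + (4 * L0 * s / real n + L0 * (8 * t / (3 * real n)))"
      using bad unfolding k_min j_def[symmetric] t_def[symmetric] distrib_left main_term .
    then have gap: "N j - 2 * A j > N k - 2 * A k + 4 * L0 * s / real n"
      using nonneg(1) unfolding risk_def N_def A_def by linarith
    \<comment> \<open>For \<open>j = k\<close> the strict \<open>gap\<close> would force a
      nonnegative number to be negative.\<close>
    with nonneg(2) have "j \<noteq> k"
      by auto
    from mult_strict_left_mono[OF gap, of "real n"]
    have "real n * N j - 2 * real n * A j > real n * N k - 2 * real n * A k + 4 * L0 * s"
      using n by (simp add: right_diff_distrib distrib_left)
    \<comment> \<open>The squared norms cancel between the empirical and the true risk; halving what
      remains turns \<open>4 * L0 * s\<close> into the threshold of \<open>B j\<close>.\<close>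
    with emp have "S j - S k > real n * (A j - A k) + 2 * L0 * s"
      by (simp add: algebra_simps)
    moreover have "(\<integral>y. (F j y - F k y) * f y \<partial>\<mu>) = A j - A k"
      unfolding A_def left_diff_distrib
      by (intro Bochner_Integration.integral_diff Ff_int j k)
    ultimately have "\<omega> \<in> B j"
      using \<omega> by (simp add: B_def S_def s_def sum_subtractf)
    with j \<open>j \<noteq> k\<close> show "\<omega> \<in> (\<Union>j\<in>{1..M} - {k}. B j)"
      by auto
  qed
  then have "prob (space \<Omega> - G) \<le> prob (\<Union>j\<in>{1..M} - {k}. B j)"
    by (intro finite_measure_mono) auto
  also have "\<dots> \<le> (\<Sum>j\<in>{1..M} - {k}. prob (B j))"
    by (intro measure_UNION_le) auto
  also have "\<dots> \<le> (\<Sum>j\<in>{1..M} - {k}. exp (- t))"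
    by (intro sum_mono B_prob) auto
  \<comment> \<open>Removing \<open>k\<close> leaves \<open>M - 1\<close> indices, and the factor
    \<open>(real M - 1) / real M\<close> is below 1. For \<open>M = 1\<close> the sum is
    empty.\<close>
  also have "\<dots> = (real M - 1) / real M * exp (- x)"
    using k M by (simp add: exp_t of_nat_diff)
  also have "\<dots> < exp (- x)"
    using M by (simp add: field_simps)
  finally have "1 - exp (- x) < prob G"
    using prob_compl[OF G_meas] by simp
  then show ?thesis
    by (simp only: G_def)
qed

end
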